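(* Let $G$ be a group and suppose that there exists an $a\in G$ such that $|G:C(a)|>3$, where $C(a)$ denotes the centralizer of $a$ in $G$. Then the endomorphism graph of $G$ is non-planar.
   Context: The endomorphism graph of a group $G$ is the simple undirected graph with vertex set $G$ in which distinct $x,y$ are adjacent if and only if some endomorphism of $G$ maps $x$ to $y$ or maps $y$ to $x$. *)

theory Defs
  imports "HOL-Analysis.Analysis" "HOL-Algebra.Coset"
begin

definition centralizer :: "('a, 'b) monoid_scheme \<Rightarrow> 'a \<Rightarrow> 'a set" where
  "centralizer G a = {g \<in> carrier G. g \<otimes>\<^bsub>G\<^esub> a = a \<otimes>\<^bsub>G\<^esub> g}"

text \<open>The index is valued in \<^typ>\<open>enat\<close>: the cardinality \<^const>\<open>card\<close> of an infinite set
  is 0, so it would give the wrong value for subgroups of infinite index.\<close>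

definition subgroup_index :: "('a, 'b) monoid_scheme \<Rightarrow> 'a set \<Rightarrow> enat" where
  "subgroup_index G H =
     (if finite (rcosets\<^bsub>G\<^esub> H) then enat (card (rcosets\<^bsub>G\<^esub> H)) else \<infinity>)"

text \<open>A simple undirected graph is a pair of a vertex set and a set of edges, the edges being
  two-element sets of vertices.\<close>

type_synonym 'a sgraph = "'a set \<times> 'a set set"

definition endomorphism_graph :: "('a, 'b) monoid_scheme \<Rightarrow> 'a sgraph" where
  "endomorphism_graph G =
     (carrier G,
      {{x, y} | x y. x \<in> carrier G \<and> y \<in> carrier G \<and> x \<noteq> y \<and>
         (\<exists>\<phi> \<in> hom G G. \<phi> x = y \<or> \<phi> y = x)})"

text \<open>A drawing places the vertices at distinct points of the plane (the type \<^typ>\<open>complex\<close>)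
  and represents each edge by an arc between the positions of its two ends. An arc passes through
  no other vertex, and two arcs have no common point apart from a common end of their edges.
  Graphs may be infinite; no discreteness or local finiteness of the drawing is demanded.\<close>

definition plane_drawing ::
    "'a sgraph \<Rightarrow> ('a \<Rightarrow> complex) \<Rightarrow> ('a set \<Rightarrow> real \<Rightarrow> complex) \<Rightarrow> bool" where
  "plane_drawing \<Gamma> p \<gamma> \<longleftrightarrow>
     inj_on p (fst \<Gamma>) \<and>
     (\<forall>e \<in> snd \<Gamma>. arc (\<gamma> e) \<and> {pathstart (\<gamma> e), pathfinish (\<gamma> e)} = p ` e \<and>
        path_image (\<gamma> e) \<inter> p ` fst \<Gamma> = p ` e) \<and>
     (\<forall>e \<in> snd \<Gamma>. \<forall>e' \<in> snd \<Gamma>. e \<noteq> e' \<longrightarrow>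
        path_image (\<gamma> e) \<inter> path_image (\<gamma> e') = p ` (e \<inter> e'))"

definition planar :: "'a sgraph \<Rightarrow> bool" where
  "planar \<Gamma> \<longleftrightarrow> (\<exists>p \<gamma>. plane_drawing \<Gamma> p \<gamma>)"

end

theory Submission
  imports Defs "HOL-Complex_Analysis.Winding_Numbers"
begin

text \<open>Conjugation by a group element is an endomorphism, so the conjugates of \<open>a\<close> are pairwise
  adjacent, and the trivial endomorphism joins every element to the identity. Distinct right cosets
  of the centralizer of \<open>a\<close> give distinct conjugates. If there are more than three cosets, four
  conjugates and the identity form a complete graph on five vertices
  (\<open>obtain_conjugates\<close>, \<open>conjugates_endomorphic\<close>), and it remains to see that such a graph has
  no drawing in the plane, even with arbitrary continuous arcs (\<open>five_clique_not_planar\<close>).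

  For this, consider a theta curve: three arcs with common ends, any two of which form a Jordan
  curve. The winding numbers of the three Jordan curves, suitably oriented, add up, and each of them
  is 0 outside its curve and a sign inside. Hence a point off the theta curve is inside none or
  exactly two of the three curves (\<open>theta_parity\<close>). Two consequences follow, because a Jordan
  curve is the boundary of its inside and of its outside: one of the three arcs is inside the curve
  formed by the other two (\<open>theta_some_arc_inside\<close>), and it is impossible that each of two arcs
  is inside the curve formed by the other one and the third
  (\<open>theta_arcs_not_mutually_inside\<close>).

  Four vertices \<open>a\<close>, \<open>b\<close>, \<open>c\<close>, \<open>d\<close> of a complete graph in the plane span four triangles, and each
  edge is one arc of a theta curve whose other arcs are the detours through the two remaining
  vertices. From this one gets that some vertex is inside the triangle of the other three
  (\<open>some_vertex_inside_opposite_triangle\<close>), that this cannot happen for two vertices at once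
  (\<open>triangles_not_mutually_inside\<close>), and that every point off the six edges is inside an
  even number of the triangles (\<open>four_triangles_parity\<close>). A fifth vertex \<open>e\<close> is joined to each of
  the four by an arc that avoids the opposite triangle. So \<open>e\<close> is inside a triangle exactly if the
  opposite vertex is, and this is so for exactly one triangle, against the parity.\<close>

section \<open>Arcs with prescribed ends\<close>

definition arc_between :: "complex \<Rightarrow> complex \<Rightarrow> complex set \<Rightarrow> bool" where
  "arc_between a b S \<longleftrightarrow> (\<exists>g. arc g \<and> pathstart g = a \<and> pathfinish g = b \<and> path_image g = S)"

lemma arc_between_sym: "arc_between a b S \<Longrightarrow> arc_between b a S"
  unfolding arc_between_def
  by (metis arc_reversepath path_image_reversepath pathfinish_reversepath pathstart_reversepath)

lemma arc_between_ends: "arc_between a b S \<Longrightarrow> a \<in> S \<and> b \<in> S \<and> a \<noteq> b"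
  unfolding arc_between_def by (metis arc_distinct_ends pathfinish_in_path_image pathstart_in_path_image)

lemma arc_between_join:
  assumes "arc_between a b S" "arc_between b c T" "S \<inter> T = {b}"
  shows "arc_between a c (S \<union> T)"
proof -
  obtain g where "arc g" "pathstart g = a" "pathfinish g = b" "path_image g = S"
    using assms(1) unfolding arc_between_def by blast
  moreover obtain h where "arc h" "pathstart h = b" "pathfinish h = c" "path_image h = T"
    using assms(2) unfolding arc_between_def by blast
  ultimately show ?thesis
    unfolding arc_between_def using assms(3)
    by (intro exI[of _ "g +++ h"]) (auto simp: path_image_join intro!: arc_join)
qed

lemma connected_arc_interior: "arc_between a b S \<Longrightarrow> connected (S - {a, b})"
  unfolding arc_between_def using arc_imp_simple_path connected_simple_path_endless by blast

lemma arc_interior_nonempty: "arc_between a b S \<Longrightarrow> S - {a, b} \<noteq> {}"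
  unfolding arc_between_def using arc_imp_simple_path nonempty_simple_path_endless by blast

lemma connected_arc_minus_end:
  assumes "arc_between a b S"
  shows "connected (S - {b})"
proof -
  obtain g where g: "arc g" "pathstart g = a" "pathfinish g = b" "path_image g = S"
    using assms unfolding arc_between_def by blast
  have inj: "inj_on g {0..1}" and cont: "continuous_on {0..1} g"
    using g(1) unfolding arc_def path_def by auto
  have "S - {b} = g ` {0..1} - g ` {1}"
    using g(3,4) by (simp add: path_image_def pathfinish_def)
  also have "\<dots> = g ` ({0..1} - {1})"
    using inj by (intro inj_on_image_set_diff[symmetric]) auto
  also have "{0..1} - {1} = {0..<1::real}"
    by auto
  finally show ?thesis
    using connected_continuous_image[OF continuous_on_subset[OF cont, of "{0..<1}"]]
    by fastforce
qed

lemma connected_subset_inside: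
  assumes "connected K" "K \<inter> C = {}" "x \<in> K" "x \<in> inside C"
  shows "K \<subseteq> inside C"
proof
  fix y assume "y \<in> K"
  then have "connected_component (- C) x y"
    using assms unfolding connected_component_def by blast
  then show "y \<in> inside C"
    using inside_same_component assms(4) by blast
qed

text \<open>The Jordan curve theorem for a closed curve that is given as the union of two arcs, so that
  no orientation or parametrization has to be chosen later.\<close>

lemma Jordan_two_arcs:
  assumes "arc_between a b S" "arc_between a b T" "S \<inter> T = {a, b}"
  shows "open (inside (S \<union> T))" "connected (inside (S \<union> T))" "bounded (inside (S \<union> T))"
    "connected (outside (S \<union> T))" "\<not> bounded (outside (S \<union> T))"
    "frontier (inside (S \<union> T)) = S \<union> T" "frontier (outside (S \<union> T)) = S \<union> T"
    "inside (S \<union> T) \<noteq> {}"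
proof -
  obtain g where g: "arc g" "pathstart g = a" "pathfinish g = b" "path_image g = S"
    using assms(1) unfolding arc_between_def by blast
  obtain h where h: "arc h" "pathstart h = b" "pathfinish h = a" "path_image h = T"
    using arc_between_sym[OF assms(2)] unfolding arc_between_def by blast
  have "simple_path (g +++ h)" "pathfinish (g +++ h) = pathstart (g +++ h)"
    "path_image (g +++ h) = S \<union> T"
    using g h assms(3) by (auto intro!: simple_path_join_loop simp: path_image_join)
  then show "open (inside (S \<union> T))" "connected (inside (S \<union> T))" "bounded (inside (S \<union> T))"
    "connected (outside (S \<union> T))" "\<not> bounded (outside (S \<union> T))"
    "frontier (inside (S \<union> T)) = S \<union> T" "frontier (outside (S \<union> T)) = S \<union> T"
    "inside (S \<union> T) \<noteq> {}"
    using Jordan_inside_outside[of "g +++ h"] by simp_all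
qed

section \<open>Theta curves\<close>

definition theta_curve :: "complex \<Rightarrow> complex \<Rightarrow> complex set \<Rightarrow> complex set \<Rightarrow> complex set \<Rightarrow> bool"
  where
  "theta_curve a b S1 S2 S3 \<longleftrightarrow>
     arc_between a b S1 \<and> arc_between a b S2 \<and> arc_between a b S3 \<and>
     S1 \<inter> S2 = {a, b} \<and> S1 \<inter> S3 = {a, b} \<and> S2 \<inter> S3 = {a, b}"

lemma theta_curve_swap:
  assumes "theta_curve a b S1 S2 S3"
  shows "theta_curve a b S2 S1 S3" "theta_curve a b S1 S3 S2"
  using assms unfolding theta_curve_def by (auto simp: Int_commute)

text \<open>The loop that runs along \<open>g\<close> and back along \<open>h\<close> has the difference as its winding
  number. Written in this form, the winding numbers of the three loops of a theta curve are related
  by plain arithmetic.\<close>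

lemma winding_number_two_arcs:
  assumes g: "arc g" "pathstart g = a" "pathfinish g = b"
    and h: "arc h" "pathstart h = a" "pathfinish h = b"
    and meet: "path_image g \<inter> path_image h = {a, b}"
    and z: "z \<notin> path_image g \<union> path_image h"
  shows "winding_number g z - winding_number h z \<in> {-1, 0, 1}"
    and "z \<in> inside (path_image g \<union> path_image h) \<longleftrightarrow> winding_number g z - winding_number h z \<noteq> 0"
proof -
  let ?c = "g +++ reversepath h"
  have simple: "simple_path ?c"
    using g h meet by (intro simple_path_join_loop) (auto simp: arc_reversepath)
  have closed: "pathfinish ?c = pathstart ?c" and image: "path_image ?c = path_image g \<union> path_image h"
    using g h by (simp_all add: path_image_join)
  have wn: "winding_number ?c z = winding_number g z - winding_number h z"
    using g h z by (simp add: winding_number_join winding_number_reversepath arc_imp_path)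
  have "winding_number ?c z \<in> {-1, 0, 1} \<and> (z \<in> inside (path_image ?c) \<longleftrightarrow> winding_number ?c z \<noteq> 0)"
  proof (cases "z \<in> inside (path_image ?c)")
    case True
    then have "winding_number ?c z = 1 \<or> winding_number ?c z = -1"
      using simple_closed_path_winding_number_inside[OF simple] by metis
    then show ?thesis
      using True by auto
  next
    case False
    then have "z \<in> outside (path_image ?c)"
      using z image inside_Un_outside[of "path_image ?c"] by blast
    then have "winding_number ?c z = 0"
      using winding_number_zero_in_outside simple_path_imp_path[OF simple] closed by blast
    then show ?thesis
      using False by simp
  qed
  then show "winding_number g z - winding_number h z \<in> {-1, 0, 1}"
    and "z \<in> inside (path_image g \<union> path_image h) \<longleftrightarrow> winding_number g z - winding_number h z \<noteq> 0"
    unfolding wn image by blast+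
qed

lemma theta_curveD:
  assumes "theta_curve a b S1 S2 S3"
  shows "arc_between a b S1" "arc_between a b S2" "arc_between a b S3"
    "S1 \<inter> S2 = {a, b}" "S1 \<inter> S3 = {a, b}" "S2 \<inter> S3 = {a, b}"
  using assms unfolding theta_curve_def by auto

text \<open>With \<open>w\<^sub>i\<close> the winding number of the \<open>i\<close>-th arc around \<open>z\<close>, the three curves have the winding
  numbers \<open>w\<^sub>1 - w\<^sub>2\<close>, \<open>w\<^sub>2 - w\<^sub>3\<close> and their sum \<open>w\<^sub>1 - w\<^sub>3\<close>.\<close>

lemma theta_parity:
  assumes "theta_curve a b S1 S2 S3" and z: "z \<notin> S1 \<union> S2 \<union> S3"
  shows "z \<in> inside (S1 \<union> S2) \<longleftrightarrow> (z \<in> inside (S1 \<union> S3)) \<noteq> (z \<in> inside (S2 \<union> S3))"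
proof -
  note arcs = theta_curveD[OF assms(1)]
  obtain g1 where g1: "arc g1" "pathstart g1 = a" "pathfinish g1 = b" "path_image g1 = S1"
    using arcs(1) unfolding arc_between_def by blast
  obtain g2 where g2: "arc g2" "pathstart g2 = a" "pathfinish g2 = b" "path_image g2 = S2"
    using arcs(2) unfolding arc_between_def by blast
  obtain g3 where g3: "arc g3" "pathstart g3 = a" "pathfinish g3 = b" "path_image g3 = S3"
    using arcs(3) unfolding arc_between_def by blast
  have z': "z \<notin> S1 \<union> S2" "z \<notin> S1 \<union> S3" "z \<notin> S2 \<union> S3"
    using z by auto
  note w12 = winding_number_two_arcs[OF g1(1-3) g2(1-3), of z, unfolded g1(4) g2(4), OF arcs(4) z'(1)]
    and w13 = winding_number_two_arcs[OF g1(1-3) g3(1-3), of z, unfolded g1(4) g3(4), OF arcs(5) z'(2)]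
    and w23 = winding_number_two_arcs[OF g2(1-3) g3(1-3), of z, unfolded g2(4) g3(4), OF arcs(6) z'(3)]
  \<comment> \<open>If none of the three were 0, one sign would be the sum of two signs.\<close>
  have signs: "(x \<noteq> 0) = ((y \<noteq> 0) \<noteq> (w \<noteq> 0))"
    if "x \<in> {-1, 0, 1}" "y \<in> {-1, 0, 1}" "w \<in> {-1, 0, 1}" "y = x + w" for x y w :: complex
    using that by auto
  show ?thesis
    unfolding w12(2) w13(2) w23(2) using w12(1) w13(1) w23(1) by (rule signs) simp
qed

lemma theta_arc_in_inside:
  assumes "theta_curve a b S1 S2 S3" "x \<in> S3 - {a, b}" "x \<in> inside (S1 \<union> S2)"
  shows "S3 - {a, b} \<subseteq> inside (S1 \<union> S2)"
  using assms unfolding theta_curve_def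
  by (intro connected_subset_inside[OF connected_arc_interior]) auto

text \<open>If the third arc does not enter the inside of the first two, nor the second arc the inside
  of the other two, then each of these insides is a connected set that avoids the boundary of the
  other. If they met they would coincide, and so would their boundaries. The
  hypotheses name a single point of each arc, because the interior of an arc lies on one side.\<close>

lemma theta_insides_disjoint:
  assumes th: "theta_curve a b S1 S2 S3"
    and x3: "x3 \<in> S3 - {a, b}" "x3 \<notin> inside (S1 \<union> S2)"
    and x2: "x2 \<in> S2 - {a, b}" "x2 \<notin> inside (S1 \<union> S3)"
  shows "inside (S1 \<union> S2) \<inter> inside (S1 \<union> S3) = {}"
proof (rule ccontr)
  assume "inside (S1 \<union> S2) \<inter> inside (S1 \<union> S3) \<noteq> {}"
  then obtain z where z: "z \<in> inside (S1 \<union> S2)" "z \<in> inside (S1 \<union> S3)" by blast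
  note th' = theta_curve_swap(2)[OF th]
  note arcs = theta_curveD[OF th]
  note J2 = Jordan_two_arcs[OF arcs(1,2,4)] and J3 = Jordan_two_arcs[OF arcs(1,3,5)]
  have "inside (S1 \<union> S2) \<inter> (S3 - {a, b}) = {}"
    using theta_arc_in_inside[OF th] x3 by blast
  then have "inside (S1 \<union> S2) \<inter> (S1 \<union> S3) = {}"
    using inside_no_overlap[of "S1 \<union> S2"] arcs(4-6) by blast
  then have "inside (S1 \<union> S2) \<subseteq> inside (S1 \<union> S3)"
    using connected_subset_inside J2(2) z by blast
  moreover
  have "inside (S1 \<union> S3) \<inter> (S2 - {a, b}) = {}"
    using theta_arc_in_inside[OF th'] x2 by blast
  then have "inside (S1 \<union> S3) \<inter> (S1 \<union> S2) = {}"
    using inside_no_overlap[of "S1 \<union> S3"] arcs(4-6) by blast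
  then have "inside (S1 \<union> S3) \<subseteq> inside (S1 \<union> S2)"
    using connected_subset_inside J3(2) z by blast
  ultimately have "inside (S1 \<union> S2) = inside (S1 \<union> S3)"
    by (rule subset_antisym)
  then have "S1 \<union> S2 = S1 \<union> S3"
    using J2(6) J3(6) by metis
  then show False
    using x3(1) arcs(5,6) by blast
qed

text \<open>Otherwise the three insides are pairwise disjoint and avoid all three arcs. A point in one
  of them is then inside a single curve, against the parity.\<close>

lemma theta_some_arc_inside:
  assumes th: "theta_curve a b S1 S2 S3"
    and x: "x1 \<in> S1 - {a, b}" "x2 \<in> S2 - {a, b}" "x3 \<in> S3 - {a, b}"
  shows "x1 \<in> inside (S2 \<union> S3) \<or> x2 \<in> inside (S1 \<union> S3) \<or> x3 \<in> inside (S1 \<union> S2)"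
proof (rule ccontr)
  assume "\<not> ?thesis"
  then have out: "x1 \<notin> inside (S2 \<union> S3)" "x2 \<notin> inside (S1 \<union> S3)" "x3 \<notin> inside (S1 \<union> S2)"
    by auto
  note arcs = theta_curveD[OF th]
  obtain z where z: "z \<in> inside (S1 \<union> S2)"
    using Jordan_two_arcs(8)[OF arcs(1,2,4)] by blast
  have "z \<notin> S3 - {a, b}"
    using theta_arc_in_inside[OF th _] z x(3) out(3) by blast
  then have "z \<notin> S1 \<union> S2 \<union> S3"
    using inside_no_overlap[of "S1 \<union> S2"] z arcs(4-6) by blast
  then have "z \<in> inside (S1 \<union> S3) \<or> z \<in> inside (S2 \<union> S3)"
    using theta_parity[OF th] z by blast
  moreover have "inside (S1 \<union> S2) \<inter> inside (S1 \<union> S3) = {}"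
    using theta_insides_disjoint[OF th] x out by blast
  moreover have "inside (S2 \<union> S1) \<inter> inside (S2 \<union> S3) = {}"
    using theta_insides_disjoint[OF theta_curve_swap(1)[OF th] x(3) _ x(1)] out
    by (simp add: Un_commute)
  ultimately show False
    using z by (auto simp: Un_commute)
qed

text \<open>If the third arc is inside the curve of the first two, the outside of that curve is a
  connected set that avoids the first and third arcs. It comes close to every point of the second
  arc, so if that one were inside the curve of the first and third, then the whole of this unbounded
  set would be.\<close>

lemma theta_arcs_not_mutually_inside:
  assumes th: "theta_curve a b S1 S2 S3"
    and x2: "x2 \<in> S2 - {a, b}" "x2 \<in> inside (S1 \<union> S3)"
    and x3: "x3 \<in> S3 - {a, b}" "x3 \<in> inside (S1 \<union> S2)"
  shows False
proof -
  note arcs = theta_curveD[OF th]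
  note out = Jordan_two_arcs(4,5,7)[OF arcs(1,2,4)] and ins = Jordan_two_arcs(1,3)[OF arcs(1,3,5)]
  have "x2 \<in> frontier (outside (S1 \<union> S2))"
    unfolding out(3) using x2(1) by blast
  then have "x2 \<in> closure (outside (S1 \<union> S2))"
    by (simp add: frontier_def)
  then obtain y where y: "y \<in> outside (S1 \<union> S2)" "y \<in> inside (S1 \<union> S3)"
    using open_Int_closure_eq_empty[OF ins(1)] x2(2) by blast
  have "S3 - {a, b} \<subseteq> inside (S1 \<union> S2)"
    using theta_arc_in_inside[OF th x3] .
  then have "outside (S1 \<union> S2) \<inter> (S1 \<union> S3) = {}"
    using outside_no_overlap[of "S1 \<union> S2"] inside_Int_outside[of "S1 \<union> S2"] arcs(4-6) by blast
  then have "outside (S1 \<union> S2) \<subseteq> inside (S1 \<union> S3)"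
    using connected_subset_inside out(1) y by blast
  then show False
    using ins(2) out(2) bounded_subset by blast
qed

section \<open>Complete graphs in the plane\<close>

text \<open>A drawing of a complete graph, with the vertices identified with their positions. An edge is
  a function of its two ends rather than of a set, so that a term \<open>A x y\<close> shows the arc that it
  denotes.\<close>

locale plane_complete_graph =
  fixes W :: "complex set" and A :: "complex \<Rightarrow> complex \<Rightarrow> complex set"
  assumes edge_arc: "x \<in> W \<Longrightarrow> y \<in> W \<Longrightarrow> x \<noteq> y \<Longrightarrow> arc_between x y (A x y)"
    and edge_sym: "A x y = A y x"
    and edges_meet: "x \<in> W \<Longrightarrow> y \<in> W \<Longrightarrow> x \<noteq> y \<Longrightarrow> u \<in> W \<Longrightarrow> v \<in> W \<Longrightarrow> u \<noteq> v \<Longrightarrow>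
      {x, y} \<noteq> {u, v} \<Longrightarrow> A x y \<inter> A u v = {x, y} \<inter> {u, v}"
begin

text \<open>A triangle is split into one edge and the detour through the third vertex, since these are
  two of the arcs of the theta curve at that edge.\<close>

definition cycle3 :: "complex \<Rightarrow> complex \<Rightarrow> complex \<Rightarrow> complex set" where
  "cycle3 x y z = A x y \<union> (A x z \<union> A z y)"

lemma cycle3_sym: "cycle3 x y z = cycle3 y x z" "cycle3 x y z = cycle3 x z y"
  unfolding cycle3_def using edge_sym[of x y] edge_sym[of x z] edge_sym[of y z] by auto

lemma cycle3_opposite: "cycle3 x y z = A y z \<union> (A y x \<union> A x z)"
  unfolding cycle3_def using edge_sym[of x y] edge_sym[of y z] by auto

lemma four_cycle_two_ways:
  "(A c a \<union> A a d) \<union> (A c b \<union> A b d) = (A a c \<union> A c b) \<union> (A a d \<union> A d b)"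
  using edge_sym[of a c] edge_sym[of b d] by auto

lemma edge_ends: "x \<in> W \<Longrightarrow> y \<in> W \<Longrightarrow> x \<noteq> y \<Longrightarrow> x \<in> A x y \<and> y \<in> A x y"
  using arc_between_ends edge_arc by blast

lemma edges_at_vertex:
  assumes W: "{x, y, z} \<subseteq> W" and D: "distinct [x, y, z]"
  shows "A x y \<inter> A x z = {x}" "A y x \<inter> A x z = {x}" "A y x \<inter> A z x = {x}"
proof -
  have "A x y \<inter> A x z = {x, y} \<inter> {x, z}"
    using W D by (intro edges_meet) (simp_all add: doubleton_eq_iff)
  also have "\<dots> = {x}"
    using D by auto
  finally show "A x y \<inter> A x z = {x}" "A y x \<inter> A x z = {x}" "A y x \<inter> A z x = {x}"
    by (simp_all add: edge_sym[of y x] edge_sym[of z x])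
qed

lemma disjoint_edges:
  assumes W: "{x, y, u, v} \<subseteq> W" and D: "distinct [x, y, u, v]"
  shows "A x y \<inter> A u v = {}"
proof -
  have "A x y \<inter> A u v = {x, y} \<inter> {u, v}"
    using W D by (intro edges_meet) (simp_all add: doubleton_eq_iff)
  also have "\<dots> = {}"
    using D by auto
  finally show ?thesis .
qed

lemma vertex_notin_edge:
  assumes "{x, y, z} \<subseteq> W" "distinct [x, y, z]"
  shows "z \<notin> A x y"
  using edges_at_vertex(1)[OF assms] edge_ends[of x z] assms by auto

text \<open>The edge between two vertices and the two detours through a third and a fourth one.\<close>

lemma theta_at_edge:
  assumes W: "{a, b, c, d} \<subseteq> W" and D: "distinct [a, b, c, d]"
  shows "theta_curve a b (A a b) (A a c \<union> A c b) (A a d \<union> A d b)"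
proof -
  have D': "distinct [d, c, b, a]"
    using D by auto
  have paths: "A a c \<inter> A c b = {c}" "A a d \<inter> A d b = {d}"
    using edges_at_vertex(2)[of c a b] edges_at_vertex(2)[of d a b] W D D' by simp_all
  have meet: "A a b \<inter> A a c = {a}" "A a b \<inter> A c b = {b}" "A a b \<inter> A a d = {a}" "A a b \<inter> A d b = {b}"
    "A a c \<inter> A a d = {a}" "A a c \<inter> A d b = {}" "A c b \<inter> A a d = {}" "A c b \<inter> A d b = {b}"
    using edges_at_vertex(1)[of a b c] edges_at_vertex(3)[of b a c]
      edges_at_vertex(1)[of a b d] edges_at_vertex(3)[of b a d]
      edges_at_vertex(1)[of a c d] disjoint_edges[of a c d b] disjoint_edges[of c b a d]
      edges_at_vertex(3)[of b c d] W D D' by simp_all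
  have "arc_between a b (A a b)" "arc_between a c (A a c)" "arc_between c b (A c b)"
    "arc_between a d (A a d)" "arc_between d b (A d b)"
    using edge_arc[of a b] edge_arc[of a c] edge_arc[of c b] edge_arc[of a d] edge_arc[of d b]
      W D D' by simp_all
  then have "arc_between a b (A a b)" "arc_between a b (A a c \<union> A c b)" "arc_between a b (A a d \<union> A d b)"
    using arc_between_join paths by blast+
  moreover have "A a b \<inter> (A a c \<union> A c b) = {a, b}" "A a b \<inter> (A a d \<union> A d b) = {a, b}"
    unfolding Int_Un_distrib meet by auto
  moreover have "(A a c \<union> A c b) \<inter> (A a d \<union> A d b) = {a, b}"
    unfolding Int_Un_distrib Int_Un_distrib2 meet by auto
  ultimately show ?thesis
    unfolding theta_curve_def by blast
qed

lemma theta_at_edge_points: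
  assumes W: "{a, b, c, d} \<subseteq> W" and D: "distinct [a, b, c, d]"
  shows "c \<in> (A a c \<union> A c b) - {a, b}" "d \<in> (A a d \<union> A d b) - {a, b}"
  using edge_ends[of a c] edge_ends[of a d] assms by auto

text \<open>The theta curves at the opposite edges \<open>ab\<close> and \<open>cd\<close> share the four-cycle \<open>acbd\<close>. The
  parity rule at \<open>ab\<close> says that \<open>z\<close> is inside the four-cycle if and only if it is inside exactly one
  of the triangles over \<open>ab\<close>, and likewise at \<open>cd\<close>.\<close>

lemma four_triangles_parity:
  assumes W: "{a, b, c, d} \<subseteq> W" and D: "distinct [a, b, c, d]"
    and z: "z \<notin> A a b \<union> A a c \<union> A a d \<union> A b c \<union> A b d \<union> A c d"
  shows "((z \<in> inside (cycle3 a b c)) \<noteq> (z \<in> inside (cycle3 a b d))) =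
    ((z \<in> inside (cycle3 a c d)) \<noteq> (z \<in> inside (cycle3 b c d)))"
proof -
  have "theta_curve a b (A a b) (A a c \<union> A c b) (A a d \<union> A d b)"
    "theta_curve c d (A c d) (A c a \<union> A a d) (A c b \<union> A b d)"
    using W D by (intro theta_at_edge; auto)+
  note p = this[THEN theta_parity, of z]
  have "z \<notin> A a b \<union> (A a c \<union> A c b) \<union> (A a d \<union> A d b)"
    "z \<notin> A c d \<union> (A c a \<union> A a d) \<union> (A c b \<union> A b d)"
    using z edge_sym by auto
  then show ?thesis
    using p unfolding cycle3_def[of a b c] cycle3_def[of a b d]
      cycle3_opposite[of a c d] cycle3_opposite[of b c d] four_cycle_two_ways by blast
qed

lemma triangles_not_mutually_inside:
  assumes W: "{a, b, c, d} \<subseteq> W" and D: "distinct [a, b, c, d]"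
  shows "\<not> (d \<in> inside (cycle3 a b c) \<and> c \<in> inside (cycle3 a b d))"
  unfolding cycle3_def
  using theta_arcs_not_mutually_inside[OF theta_at_edge[OF W D] theta_at_edge_points(1)[OF W D]
      _ theta_at_edge_points(2)[OF W D]]
  by metis

text \<open>Nothing but the last point of an edge from \<open>w\<close> to a vertex of the triangle is on the
  triangle, so the rest of the edge stays on one side.\<close>

lemma edge_into_triangle_inside:
  assumes W: "{a, b, c, w} \<subseteq> W" and D: "distinct [a, b, c, w]"
    and x: "x \<in> A w c - {c}" "x \<in> inside (cycle3 a b c)"
  shows "w \<in> inside (cycle3 a b c)"
proof -
  have D': "distinct [w, c, b, a]"
    using D by auto
  have arc: "arc_between w c (A w c)"
    using W D by (intro edge_arc) auto
  have "A w c \<inter> A a b = {}" "A w c \<inter> A a c = {c}" "A w c \<inter> A c b = {c}"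
    using disjoint_edges[of w c a b] edges_at_vertex(3)[of c w a] edges_at_vertex(2)[of c w b]
      W D D' by simp_all
  then have "(A w c - {c}) \<inter> cycle3 a b c = {}"
    unfolding cycle3_def by blast
  moreover have "w \<in> A w c - {c}"
    using arc_between_ends[OF arc] by auto
  ultimately show ?thesis
    using connected_subset_inside[OF connected_arc_minus_end[OF arc]] x by blast
qed

text \<open>Suppose there is no such vertex. In the theta curve at \<open>cd\<close> only the edge itself can then be
  the arc inside the curve of the other two, which is the four-cycle \<open>acbd\<close>. By the parity rule at
  \<open>ab\<close>, a point of the edge \<open>cd\<close> is inside the triangle \<open>abc\<close> or inside the triangle \<open>abd\<close>. The
  edge leads from there to \<open>d\<close> or to \<open>c\<close> without meeting that triangle.\<close>

lemma some_vertex_inside_opposite_triangle: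
  assumes W: "{a, b, c, d} \<subseteq> W" and D: "distinct [a, b, c, d]"
  shows "d \<in> inside (cycle3 a b c) \<or> c \<in> inside (cycle3 a b d) \<or>
    b \<in> inside (cycle3 a c d) \<or> a \<in> inside (cycle3 b c d)"
proof (rule ccontr)
  assume "\<not> ?thesis"
  then have out: "d \<notin> inside (cycle3 a b c)" "c \<notin> inside (cycle3 a b d)"
    "b \<notin> inside (cycle3 a c d)" "a \<notin> inside (cycle3 b c d)" by auto
  have W': "{c, d, a, b} \<subseteq> W" and D': "distinct [c, d, a, b]"
    using W D by auto
  have "d \<noteq> c" and cd: "arc_between c d (A c d)"
    using W D by (auto intro: edge_arc)
  obtain x where x: "x \<in> A c d - {c, d}"
    using arc_interior_nonempty[OF cd] by blast
  have "x \<in> inside ((A a c \<union> A c b) \<union> (A a d \<union> A d b))"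
    using theta_some_arc_inside[OF theta_at_edge[OF W' D'] x theta_at_edge_points[OF W' D']] out(3,4)
    unfolding cycle3_opposite[of a c d] cycle3_opposite[of b c d] four_cycle_two_ways by blast
  moreover have "x \<notin> A a b"
    using disjoint_edges[OF W D] x by blast
  moreover note inside_no_overlap[of "(A a c \<union> A c b) \<union> (A a d \<union> A d b)"]
  ultimately have "x \<in> inside (cycle3 a b c) \<or> x \<in> inside (cycle3 a b d)"
    using theta_parity[OF theta_at_edge[OF W D], of x] unfolding cycle3_def by blast
  then show False
  proof
    assume "x \<in> inside (cycle3 a b c)"
    then have "d \<in> inside (cycle3 a b c)"
      using edge_into_triangle_inside[of a b c d x] W D x edge_sym[of c d] by simp
    then show False using out by blast
  next
    assume "x \<in> inside (cycle3 a b d)"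
    then have "c \<in> inside (cycle3 a b d)"
      using edge_into_triangle_inside[of a b d c x] W D \<open>d \<noteq> c\<close> x by simp
    then show False using out by blast
  qed
qed

lemma same_side_of_triangle:
  assumes W: "{a, b, c, d, e} \<subseteq> W" and D: "distinct [a, b, c, d, e]"
  shows "d \<in> inside (cycle3 a b c) \<longleftrightarrow> e \<in> inside (cycle3 a b c)"
proof -
  have D': "distinct [e, d, c, b, a]"
    using D by auto
  have arc: "arc_between d e (A d e)"
    using W D by (intro edge_arc) auto
  have "A d e \<inter> A a b = {}" "A d e \<inter> A a c = {}" "A d e \<inter> A c b = {}"
    using disjoint_edges[of d e a b] disjoint_edges[of d e a c] disjoint_edges[of d e c b]
      W D D' by simp_all
  then have "A d e \<inter> cycle3 a b c = {}"
    unfolding cycle3_def by blast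
  moreover have "connected (A d e)"
    using arc unfolding arc_between_def by (metis arc_imp_path connected_path_image)
  ultimately show ?thesis
    using connected_subset_inside arc_between_ends[OF arc] by blast
qed

text \<open>One of the triangles among \<open>a\<close>, \<open>b\<close>, \<open>c\<close>, \<open>d\<close> has its opposite vertex inside, hence also
  \<open>e\<close>. By parity \<open>e\<close> is inside a second triangle, which therefore has its opposite vertex inside. The six
  instances of \<open>triangles_not_mutually_inside\<close> rule out every pair of triangles.\<close>

theorem no_five_vertices:
  assumes W: "{a, b, c, d, e} \<subseteq> W" and D: "distinct [a, b, c, d, e]"
  shows False
proof -
  have same: "d \<in> inside (cycle3 a b c) \<longleftrightarrow> e \<in> inside (cycle3 a b c)"
    "c \<in> inside (cycle3 a b d) \<longleftrightarrow> e \<in> inside (cycle3 a b d)"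
    "b \<in> inside (cycle3 a c d) \<longleftrightarrow> e \<in> inside (cycle3 a c d)"
    "a \<in> inside (cycle3 b c d) \<longleftrightarrow> e \<in> inside (cycle3 b c d)"
    using W D by (intro same_side_of_triangle; auto)+
  have "e \<notin> A a b" "e \<notin> A a c" "e \<notin> A a d" "e \<notin> A b c" "e \<notin> A b d" "e \<notin> A c d"
    using W D by (intro vertex_notin_edge; auto)+
  then have "((e \<in> inside (cycle3 a b c)) \<noteq> (e \<in> inside (cycle3 a b d))) =
    ((e \<in> inside (cycle3 a c d)) \<noteq> (e \<in> inside (cycle3 b c d)))"
    using W D by (intro four_triangles_parity) auto
  moreover have "e \<in> inside (cycle3 a b c) \<or> e \<in> inside (cycle3 a b d) \<or>
    e \<in> inside (cycle3 a c d) \<or> e \<in> inside (cycle3 b c d)"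
    using some_vertex_inside_opposite_triangle[of a b c d] W D same by auto
  moreover have
    "\<not> (d \<in> inside (cycle3 a b c) \<and> c \<in> inside (cycle3 a b d))"
    "\<not> (d \<in> inside (cycle3 a c b) \<and> b \<in> inside (cycle3 a c d))"
    "\<not> (c \<in> inside (cycle3 a d b) \<and> b \<in> inside (cycle3 a d c))"
    "\<not> (d \<in> inside (cycle3 b c a) \<and> a \<in> inside (cycle3 b c d))"
    "\<not> (c \<in> inside (cycle3 b d a) \<and> a \<in> inside (cycle3 b d c))"
    "\<not> (b \<in> inside (cycle3 c d a) \<and> a \<in> inside (cycle3 c d b))"
    using W D by (intro triangles_not_mutually_inside; auto)+
  moreover have "cycle3 a c b = cycle3 a b c" "cycle3 a d b = cycle3 a b d"
    "cycle3 a d c = cycle3 a c d" "cycle3 b c a = cycle3 a b c"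
    "cycle3 b d a = cycle3 a b d" "cycle3 b d c = cycle3 b c d"
    "cycle3 c d a = cycle3 a c d" "cycle3 c d b = cycle3 b c d"
    using cycle3_sym by metis+
  ultimately show False
    using same by auto
qed

end

theorem five_clique_not_planar:
  assumes K: "K \<subseteq> fst \<Gamma>" "card K = 5"
    and clique: "\<And>x y. x \<in> K \<Longrightarrow> y \<in> K \<Longrightarrow> x \<noteq> y \<Longrightarrow> {x, y} \<in> snd \<Gamma>"
  shows "\<not> planar \<Gamma>"
proof
  assume "planar \<Gamma>"
  then obtain p \<gamma> where draw: "plane_drawing \<Gamma> p \<gamma>"
    unfolding planar_def by blast
  then have inj: "inj_on p K"
    using K(1) unfolding plane_drawing_def by (auto intro: inj_on_subset)
  define q where "q = inv_into K p"
  have q: "q x \<in> K" "p (q x) = x" if "x \<in> p ` K" for x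
    using that unfolding q_def by (auto intro: inv_into_into f_inv_into_f)
  have q_edge: "{q x, q y} \<in> snd \<Gamma>" if "x \<in> p ` K" "y \<in> p ` K" "x \<noteq> y" for x y
    using that q by (metis clique)
  have edges_cross: "path_image (\<gamma> e) \<inter> path_image (\<gamma> e') = p ` (e \<inter> e')"
    if "e \<in> snd \<Gamma>" "e' \<in> snd \<Gamma>" "e \<noteq> e'" for e e'
    using draw that unfolding plane_drawing_def by simp
  define A where "A = (\<lambda>x y. path_image (\<gamma> {q x, q y}))"
  interpret plane_complete_graph "p ` K" A
  proof
    fix x y assume xy: "x \<in> p ` K" "y \<in> p ` K" "x \<noteq> y"
    have "arc (\<gamma> {q x, q y})" "{pathstart (\<gamma> {q x, q y}), pathfinish (\<gamma> {q x, q y})} = {x, y}"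
      using draw q_edge[OF xy] q xy unfolding plane_drawing_def by auto
    then have "arc_between x y (A x y) \<or> arc_between y x (A x y)"
      unfolding arc_between_def A_def by (auto simp: doubleton_eq_iff)
    then show "arc_between x y (A x y)"
      using arc_between_sym by blast
  next
    show "A x y = A y x" for x y
      unfolding A_def by (simp add: insert_commute)
  next
    fix x y u v
    assume xy: "x \<in> p ` K" "y \<in> p ` K" "x \<noteq> y" and uv: "u \<in> p ` K" "v \<in> p ` K" "u \<noteq> v"
      and ne: "{x, y} \<noteq> {u, v}"
    have "p ` {q x, q y} \<noteq> p ` {q u, q v}"
      using ne q(2) xy uv by simp
    then have "{q x, q y} \<noteq> {q u, q v}"
      by metis
    then have "A x y \<inter> A u v = p ` ({q x, q y} \<inter> {q u, q v})"
      unfolding A_def by (intro edges_cross q_edge xy uv)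
    also have "\<dots> = p ` {q x, q y} \<inter> p ` {q u, q v}"
      using inj q(1) xy uv by (intro inj_on_image_Int[of _ K]) auto
    also have "\<dots> = {x, y} \<inter> {u, v}"
      using q(2) xy uv by simp
    finally show "A x y \<inter> A u v = {x, y} \<inter> {u, v}" .
  qed
  have "card (p ` K) = 5"
    using K(2) card_image[OF inj] by simp
  moreover from this have "finite (p ` K)"
    by (intro card_ge_0_finite) simp
  ultimately obtain xs where xs: "set xs = p ` K" "distinct xs" "length xs = 5"
    using finite_distinct_list distinct_card by metis
  then obtain a b c d e where "xs = [a, b, c, d, e]"
    by (auto simp: length_Suc_conv eval_nat_numeral)
  then show False
    using no_five_vertices[of a b c d e] xs by auto
qed

section \<open>Conjugates in the endomorphism graph\<close>

context group
begin

lemma mult_inv_cancel: "k \<in> carrier G \<Longrightarrow> x \<in> carrier G \<Longrightarrow> k \<otimes> (inv k \<otimes> x) = x"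
  by (simp flip: m_assoc)

lemma inv_mult_cancel: "k \<in> carrier G \<Longrightarrow> x \<in> carrier G \<Longrightarrow> inv k \<otimes> (k \<otimes> x) = x"
  by (simp flip: m_assoc)

lemma inner_hom: "k \<in> carrier G \<Longrightarrow> (\<lambda>x. inv k \<otimes> x \<otimes> k) \<in> hom G G"
  by (auto simp: hom_def m_assoc mult_inv_cancel)

lemma centralizer_subgroup: "a \<in> carrier G \<Longrightarrow> subgroup (centralizer G a) G"
proof (rule subgroupI)
  assume a: "a \<in> carrier G"
  show "centralizer G a \<subseteq> carrier G" "centralizer G a \<noteq> {}"
    using a one_closed unfolding centralizer_def by fastforce+
  fix g assume g: "g \<in> centralizer G a"
  then have gc: "g \<in> carrier G" "g \<otimes> a = a \<otimes> g" unfolding centralizer_def by auto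
  then have "inv g \<otimes> (g \<otimes> a) \<otimes> inv g = inv g \<otimes> (a \<otimes> g) \<otimes> inv g"
    by simp
  then have "a \<otimes> inv g = inv g \<otimes> a"
    using a gc(1) by (simp add: m_assoc inv_mult_cancel)
  then show "inv g \<in> centralizer G a"
    using gc(1) unfolding centralizer_def by simp
  fix h assume "h \<in> centralizer G a"
  then have "h \<in> carrier G" "h \<otimes> a = a \<otimes> h" unfolding centralizer_def by auto
  then show "g \<otimes> h \<in> centralizer G a"
    using gc a unfolding centralizer_def by (simp add: m_assoc) (simp add: m_assoc[symmetric])
qed

lemma conj_eq_imp_coset_eq:
  assumes a: "a \<in> carrier G" and g: "g \<in> carrier G" and h: "h \<in> carrier G"
    and eq: "inv g \<otimes> a \<otimes> g = inv h \<otimes> a \<otimes> h"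
  shows "centralizer G a #> g = centralizer G a #> h"
proof -
  let ?k = "h \<otimes> inv g"
  have "?k \<otimes> a = h \<otimes> (inv g \<otimes> a \<otimes> g) \<otimes> inv g"
    using a g h by (simp add: m_assoc)
  also have "\<dots> = a \<otimes> ?k"
    unfolding eq using a g h by (simp add: m_assoc mult_inv_cancel)
  finally have "?k \<otimes> a = a \<otimes> ?k" .
  then have "h \<otimes> inv g \<in> centralizer G a"
    using g h unfolding centralizer_def by simp
  then have "h \<in> centralizer G a #> g"
    using g h by (auto simp: r_coset_def m_assoc intro!: bexI[of _ "h \<otimes> inv g"])
  then show ?thesis
    using repr_independence centralizer_subgroup a g by blast
qed

text \<open>Choosing a representative in each right coset of the centralizer gives one conjugate per
  coset. A subset of the required size is taken among the cosets, of which there may be infinitely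
  many.\<close>

lemma obtain_conjugates:
  assumes a: "a \<in> carrier G" and index: "enat n \<le> subgroup_index G (centralizer G a)"
  obtains B where "B \<subseteq> (\<lambda>g. inv g \<otimes> a \<otimes> g) ` carrier G" "card B = n" "finite B"
proof -
  obtain Q where Q: "Q \<subseteq> rcosets (centralizer G a)" "card Q = n" "finite Q"
  proof (cases "finite (rcosets (centralizer G a))")
    case True
    then have "n \<le> card (rcosets (centralizer G a))"
      using index unfolding subgroup_index_def by simp
    then show ?thesis
      using obtain_subset_with_card_n that by metis
  next
    case False
    then show ?thesis
      using infinite_arbitrarily_large that by metis
  qed
  have "\<forall>R \<in> Q. \<exists>g \<in> carrier G. R = centralizer G a #> g"
    using Q(1) unfolding RCOSETS_def by blast
  then obtain r where r: "\<And>R. R \<in> Q \<Longrightarrow> r R \<in> carrier G"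
    "\<And>R. R \<in> Q \<Longrightarrow> R = centralizer G a #> r R" by metis
  let ?f = "\<lambda>R. inv (r R) \<otimes> a \<otimes> r R"
  have "inj_on ?f Q"
    using conj_eq_imp_coset_eq[OF a] r by (intro inj_onI) metis
  then have "card (?f ` Q) = n"
    using Q(2) card_image by blast
  then show ?thesis
    using that[of "?f ` Q"] r(1) Q(3) by blast
qed

lemma conjugates_endomorphic:
  assumes a: "a \<in> carrier G" and g: "g \<in> carrier G" and h: "h \<in> carrier G"
  shows "\<exists>\<phi> \<in> hom G G. \<phi> (inv g \<otimes> a \<otimes> g) = inv h \<otimes> a \<otimes> h"
proof
  let ?k = "inv g \<otimes> h"
  show "(\<lambda>x. inv ?k \<otimes> x \<otimes> ?k) \<in> hom G G"
    using g h by (intro inner_hom) simp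
  show "inv ?k \<otimes> (inv g \<otimes> a \<otimes> g) \<otimes> ?k = inv h \<otimes> a \<otimes> h"
    using a g h by (simp add: inv_mult_group m_assoc mult_inv_cancel)
qed

end

theorem theorem6p5:
  fixes G :: "('a, 'b) monoid_scheme"
  assumes "group G"
    and "\<exists>a \<in> carrier G. subgroup_index G (centralizer G a) > 3"
  shows "\<not> planar (endomorphism_graph G)"
proof -
  interpret group G by fact
  obtain a where a: "a \<in> carrier G" "subgroup_index G (centralizer G a) > 3"
    using assms(2) by blast
  have "enat 4 \<le> subgroup_index G (centralizer G a)"
    using a(2) by (cases "subgroup_index G (centralizer G a)") (auto simp: numeral_eq_enat)
  then obtain B where B: "B \<subseteq> (\<lambda>g. inv\<^bsub>G\<^esub> g \<otimes>\<^bsub>G\<^esub> a \<otimes>\<^bsub>G\<^esub> g) ` carrier G" "card B = 4" "finite B"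
    using obtain_conjugates[OF a(1)] by blast
  have Bc: "B \<subseteq> carrier G"
    using B(1) a(1) by auto
  have "\<one>\<^bsub>G\<^esub> \<notin> B"
  proof
    assume "\<one>\<^bsub>G\<^esub> \<in> B"
    then obtain g where g: "g \<in> carrier G" "inv\<^bsub>G\<^esub> g \<otimes>\<^bsub>G\<^esub> a \<otimes>\<^bsub>G\<^esub> g = \<one>\<^bsub>G\<^esub>"
      using B(1) by force
    have "a = g \<otimes>\<^bsub>G\<^esub> (inv\<^bsub>G\<^esub> g \<otimes>\<^bsub>G\<^esub> a \<otimes>\<^bsub>G\<^esub> g) \<otimes>\<^bsub>G\<^esub> inv\<^bsub>G\<^esub> g"
      using a(1) g(1) by (simp add: m_assoc mult_inv_cancel)
    then have "a = \<one>\<^bsub>G\<^esub>"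
      using g by simp
    \<comment> \<open>The identity is its only conjugate, which contradicts \<open>card B = 4\<close>.\<close>
    then have "B \<subseteq> {\<one>\<^bsub>G\<^esub>}"
      using B(1) by auto
    then show False
      using B(2) card_mono[of "{\<one>\<^bsub>G\<^esub>}" B] by simp
  qed
  then have card: "card (insert \<one>\<^bsub>G\<^esub> B) = 5"
    using B by simp
  have vertices: "insert \<one>\<^bsub>G\<^esub> B \<subseteq> fst (endomorphism_graph G)"
    using Bc unfolding endomorphism_graph_def by simp
  have "{x, y} \<in> snd (endomorphism_graph G)"
    if xy: "x \<in> insert \<one>\<^bsub>G\<^esub> B" "y \<in> insert \<one>\<^bsub>G\<^esub> B" "x \<noteq> y" for x y
  proof -
    have triv: "(\<lambda>_. \<one>\<^bsub>G\<^esub>) \<in> hom G G"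
      by (simp add: hom_def)
    have "\<exists>\<phi> \<in> hom G G. \<phi> x = y \<or> \<phi> y = x"
    proof (cases "x = \<one>\<^bsub>G\<^esub> \<or> y = \<one>\<^bsub>G\<^esub>")
      case True
      then show ?thesis
        by (intro bexI[OF _ triv]) auto
    next
      case False
      then have "x \<in> B" "y \<in> B"
        using xy by simp_all
      obtain g where g: "g \<in> carrier G" "x = inv\<^bsub>G\<^esub> g \<otimes>\<^bsub>G\<^esub> a \<otimes>\<^bsub>G\<^esub> g"
        using subsetD[OF B(1) \<open>x \<in> B\<close>] by (elim imageE)
      obtain h where h: "h \<in> carrier G" "y = inv\<^bsub>G\<^esub> h \<otimes>\<^bsub>G\<^esub> a \<otimes>\<^bsub>G\<^esub> h"
        using subsetD[OF B(1) \<open>y \<in> B\<close>] by (elim imageE)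
      obtain \<phi> where "\<phi> \<in> hom G G" "\<phi> x = y"
        using conjugates_endomorphic[OF a(1) g(1) h(1)] unfolding g(2) h(2) by (elim bexE)
      then show ?thesis
        by (intro bexI[of _ \<phi>]) simp_all
    qed
    moreover have "x \<in> carrier G" "y \<in> carrier G"
      using xy(1,2) Bc by auto
    ultimately show ?thesis
      using xy(3) unfolding endomorphism_graph_def snd_conv
      by - (rule CollectI, rule exI[of _ x], rule exI[of _ y], simp)
  qed
  then show ?thesis
    by (rule five_clique_not_planar[OF vertices card])
qed

end
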